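(* Let $A\in\mathbb{Z}^{m\times n}$, $\bm{b}\in\mathbb{Z}^m$, $\bm{c}\in\mathbb{Z}^n$, and let $A_{\max}\coloneqq\max_{i=1,\ldots,n}\|A_i\|_1$ be the largest $1$-norm of a column $A_i$ of $A$ (with $A_{\max}\geq 1$). If the integer linear program of optimizing $\bm{c}^\intercal\bm{x}$ subject to $A\bm{x}=\bm{b}$, $\bm{x}\in\mathbb{Z}^n_{\geq 0}$ is feasible and bounded (i.e., has an optimal solution), then it has an optimal solution $\bm{x}^\star$ with support size $s=|\operatorname{supp}(\bm{x}^\star)|\leq m\cdot\bigl(\log(3A_{\max})+\sqrt{\log(A_{\max})}\bigr)$.
   Context: $\log$ denotes the base-2 logarithm. For a vector $\bm{v}$, $\operatorname{supp}(\bm{v})\coloneqq\{\ell\mid v_\ell\neq 0\}$ and the support size is $|\operatorname{supp}(\bm{v})|$. *)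

theory Defs
  imports Complex_Main "Jordan_Normal_Form.Matrix"
begin

definition vec_supp :: "'a::zero vec \<Rightarrow> nat set" where
  "vec_supp v = {l. l < dim_vec v \<and> v $ l \<noteq> 0}"

definition vec_norm1 :: "int vec \<Rightarrow> int" where
  "vec_norm1 v = (\<Sum>i<dim_vec v. \<bar>v $ i\<bar>)"

(* Unspecified for a matrix without columns, where the maximum ranges over the empty set. *)
definition max_col_norm1 :: "int mat \<Rightarrow> int" where
  "max_col_norm1 A = Max ((\<lambda>i. vec_norm1 (col A i)) ` {..<dim_col A})"

definition ilp_feasible :: "int mat \<Rightarrow> int vec \<Rightarrow> int vec set" where
  "ilp_feasible A b = {x \<in> carrier_vec (dim_col A). A *\<^sub>v x = b \<and> (\<forall>i<dim_col A. 0 \<le> x $ i)}"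

datatype ilp_sense = Maximize | Minimize

fun ilp_bounded :: "ilp_sense \<Rightarrow> int mat \<Rightarrow> int vec \<Rightarrow> int vec \<Rightarrow> bool" where
  "ilp_bounded Maximize A b c \<longleftrightarrow> bdd_above ((\<lambda>x. c \<bullet> x) ` ilp_feasible A b)"
| "ilp_bounded Minimize A b c \<longleftrightarrow> bdd_below ((\<lambda>x. c \<bullet> x) ` ilp_feasible A b)"

fun ilp_optimal :: "ilp_sense \<Rightarrow> int mat \<Rightarrow> int vec \<Rightarrow> int vec \<Rightarrow> int vec \<Rightarrow> bool" where
  "ilp_optimal Maximize A b c x \<longleftrightarrow>
     x \<in> ilp_feasible A b \<and> (\<forall>y\<in>ilp_feasible A b. c \<bullet> y \<le> c \<bullet> x)"
| "ilp_optimal Minimize A b c x \<longleftrightarrow>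
     x \<in> ilp_feasible A b \<and> (\<forall>y\<in>ilp_feasible A b. c \<bullet> x \<le> c \<bullet> y)"

end

theory Submission
  imports Defs "HOL-Library.FuncSet"
begin

text \<open>
  Take an optimal solution \<open>x\<close> whose support has minimal size \<open>s\<close>. If two different sets of
  support columns had the same sum, the difference \<open>d\<close> of their indicator vectors would be a
  kernel vector along which \<open>x\<close> can be moved in both directions; by optimality the objective is
  constant along \<open>d\<close>, so moving on until some coordinate vanishes would shrink the support.
  Hence the \<open>2 ^ s\<close> subset sums of the support columns are distinct. In row \<open>r\<close> they lie in an
  interval with \<open>1 + R\<^sub>r\<close> integers, where \<open>R\<^sub>r\<close> is the 1-norm of that row on the support, and
  the \<open>R\<^sub>r\<close> sum up to at most \<open>s * A\<^sub>m\<^sub>a\<^sub>x\<close>. By AM-GM, \<open>t = s / m\<close> satisfies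
  \<open>2 powr t \<le> 1 + t * A\<^sub>m\<^sub>a\<^sub>x\<close>, and this forces the claimed bound.
\<close>

section \<open>Counting subset sums, and AM-GM\<close>

lemma card_inj_subset_sums_le:
  fixes a :: "nat \<Rightarrow> 'a \<Rightarrow> int"
  assumes S: "finite S"
    and inj: "inj_on (\<lambda>T. \<lambda>r\<in>{..<m}. \<Sum>j\<in>T. a r j) (Pow S)"
  shows "(2::int) ^ card S \<le> (\<Prod>r<m. 1 + (\<Sum>j\<in>S. \<bar>a r j\<bar>))"
proof -
  \<comment> \<open>The extreme subset sums of row \<open>r\<close> collect exactly its negative and
    exactly its positive entries. Their distance is the 1-norm of the row on \<open>S\<close>, so
    the interval has one more integer than that.\<close>
  define I where "I r = {(\<Sum>j\<in>S. min 0 (a r j)) .. (\<Sum>j\<in>S. max 0 (a r j))}" for r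
  have le: "(\<Sum>j\<in>S. min 0 (a r j)) \<le> (\<Sum>j\<in>S. max 0 (a r j))" for r
    by (intro sum_mono) auto
  have card_I: "int (card (I r)) = 1 + (\<Sum>j\<in>S. \<bar>a r j\<bar>)" for r
  proof -
    have "(\<Sum>j\<in>S. max 0 (a r j)) - (\<Sum>j\<in>S. min 0 (a r j)) = (\<Sum>j\<in>S. \<bar>a r j\<bar>)"
      unfolding sum_subtractf[symmetric] by (intro sum.cong) auto
    with le[of r] show ?thesis by (simp add: I_def)
  qed
  \<comment> \<open>Restricting to \<open>{..<m}\<close> makes the image lie in an extensional
    product, whose cardinality is the product of the interval sizes.\<close>
  have sub: "(\<lambda>T. \<lambda>r\<in>{..<m}. \<Sum>j\<in>T. a r j) ` Pow S \<subseteq> (\<Pi>\<^sub>E r\<in>{..<m}. I r)"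
  proof (intro image_subsetI restrict_PiE_iff[THEN iffD2] ballI)
    fix T r assume "T \<in> Pow S"
    then have T: "T \<subseteq> S" by simp
    have "(\<Sum>j\<in>S. min 0 (a r j)) \<le> (\<Sum>j\<in>T. min 0 (a r j))"
      using sum_mono2[OF S T, of "\<lambda>j. - min 0 (a r j)"] by (simp add: sum_negf)
    also have "\<dots> \<le> (\<Sum>j\<in>T. a r j)" by (intro sum_mono) auto
    finally have lower: "(\<Sum>j\<in>S. min 0 (a r j)) \<le> (\<Sum>j\<in>T. a r j)" .
    have "(\<Sum>j\<in>T. a r j) \<le> (\<Sum>j\<in>T. max 0 (a r j))" by (intro sum_mono) auto
    also have "\<dots> \<le> (\<Sum>j\<in>S. max 0 (a r j))" by (intro sum_mono2 S T) auto
    finally show "(\<Sum>j\<in>T. a r j) \<in> I r" using lower by (simp add: I_def)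
  qed
  have "2 ^ card S = card ((\<lambda>T. \<lambda>r\<in>{..<m}. \<Sum>j\<in>T. a r j) ` Pow S)"
    using card_image[OF inj] card_Pow[OF S] by simp
  also have "\<dots> \<le> card (\<Pi>\<^sub>E r\<in>{..<m}. I r)"
    by (intro card_mono finite_PiE sub) (auto simp: I_def)
  also have "\<dots> = (\<Prod>r<m. card (I r))" by (simp add: card_PiE)
  finally have "int (2 ^ card S) \<le> int (\<Prod>r<m. card (I r))" by (simp only: of_nat_le_iff)
  then show ?thesis by (simp add: card_I)
qed

text \<open>AM-GM with an upper bound \<open>q\<close> for the mean: sum the tangent estimate of
  \<open>ln\<close> at \<open>q\<close>. The linear terms add up to at most 0 by the bound on the
  sum.\<close>

lemma prod_le_mean_power:
  fixes f :: "nat \<Rightarrow> real" and q :: real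
  assumes pos: "\<And>r. r < m \<Longrightarrow> f r > 0" and q: "q > 0" and le: "(\<Sum>r<m. f r) \<le> real m * q"
  shows "(\<Prod>r<m. f r) \<le> q ^ m"
proof -
  have "ln (\<Prod>r<m. f r) = (\<Sum>r<m. ln (f r))"
    by (rule ln_prod) (auto dest: pos)
  also have "\<dots> \<le> (\<Sum>r<m. ln q + (f r / q - 1))"
  proof (rule sum_mono)
    fix r assume "r \<in> {..<m}"
    then have "f r > 0" using pos by simp
    then show "ln (f r) \<le> ln q + (f r / q - 1)"
      using ln_le_minus_one[of "f r / q"] q by (simp add: ln_div)
  qed
  also have "\<dots> = m * ln q + ((\<Sum>r<m. f r) / q - m)"
    by (simp add: sum.distrib sum_subtractf sum_divide_distrib)
  also have "\<dots> \<le> m * ln q" using le q by (simp add: field_simps)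
  also have "\<dots> = ln (q ^ m)" using q by (simp add: ln_realpow)
  finally show ?thesis using q pos
    by (subst (asm) ln_le_cancel_iff) (auto intro!: prod_pos)
qed

section \<open>Where \<open>2 powr t\<close> overtakes \<open>1 + t * a\<close>\<close>

lemma ln_three_le: "5 * ln (3::real) \<le> 8 * ln 2"
proof -
  have "5 * ln (3::real) = ln (3 ^ 5)" by (subst ln_realpow) auto
  also have "\<dots> \<le> ln (2 ^ 8)" by (subst ln_le_cancel_iff) auto
  also have "\<dots> = 8 * ln (2::real)" by (subst ln_realpow) auto
  finally show ?thesis .
qed

text \<open>Since \<open>exp 1 \<le> 3\<close>, \<open>ln 3\<close> is at least 1, and the previous
  estimate transfers this to \<open>ln 2\<close>.\<close>

lemma ln_two_ge: "5/8 \<le> ln (2::real)"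
  using ln_three_le ln_ge_iff[of 3 1] exp_le by simp

text \<open>With \<open>a = 2 powr L\<^sup>2\<close> and the claimed bound
  \<open>t0 = log 2 3 + L\<^sup>2 + L\<close>, this yields \<open>t0 + 1 < 3 * 2 powr L\<close>; the
  constant 13/5 is 1 plus the upper bound 8/5 for \<open>log 2 3\<close>.\<close>

lemma two_powr_ge_quadratic:
  fixes L :: real
  assumes "L \<ge> 0"
  shows "3 * 2 powr L > 13/5 + L + L\<^sup>2"
proof -
  \<comment> \<open>Half of the exponent \<open>5/8 * L\<close> is expanded, so that squaring turns
    the quadratic Taylor bound into a quartic one.\<close>
  have "1 + 5/16 * L + 25/512 * L\<^sup>2 \<le> exp (5/16 * L)"
    using exp_lower_Taylor_quadratic[of "5/16 * L"] assms by (simp add: power2_eq_square)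
  then have "(1 + 5/16 * L + 25/512 * L\<^sup>2)\<^sup>2 \<le> (exp (5/16 * L))\<^sup>2"
    by (rule power_mono) (use assms in simp)
  also have "\<dots> = exp (5/8 * L)" by (simp add: power2_eq_square flip: exp_add)
  also have "\<dots> \<le> exp (ln 2 * L)"
    using mult_right_mono[OF ln_two_ge assms] by simp
  also have "\<dots> = 2 powr L" by (simp add: powr_def mult.commute)
  finally have "3 * (1 + 5/16 * L + 25/512 * L\<^sup>2)\<^sup>2 \<le> 3 * 2 powr L" by simp
  \<comment> \<open>The negative \<open>L\<^sup>2\<close> coefficient is absorbed into a square
    centred at 5/2, chosen so that all remaining coefficients are positive.\<close>
  moreover have "3 * (1 + 5/16 * L + 25/512 * L\<^sup>2)\<^sup>2 - (13/5 + L + L\<^sup>2)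
      = 2/5 + L * (375/4096 * (L - 5/2)\<^sup>2 + 179/4096 * L + 4961/16384) + 1875/262144 * L^4"
    by (simp add: power2_eq_square power4_eq_xxxx field_simps)
  moreover have "2/5 + L * (375/4096 * (L - 5/2)\<^sup>2 + 179/4096 * L + 4961/16384) + 1875/262144 * L^4 > 0"
    using assms by (intro add_pos_nonneg mult_nonneg_nonneg add_nonneg_nonneg) auto
  ultimately show ?thesis by linarith
qed

text \<open>At \<open>t0\<close> the exponential is already above the line. Its slope there is at
  least \<open>ln 2 * 3 * a\<close>, which exceeds the slope \<open>a\<close> of the line, so by
  convexity it stays above for all larger \<open>t\<close>.\<close>

lemma two_powr_le_linear_imp_le:
  fixes a t :: real
  assumes a: "a \<ge> 1" and t: "2 powr t \<le> 1 + t * a"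
  shows "t \<le> log 2 (3 * a) + sqrt (log 2 a)"
proof (rule ccontr)
  define L where "L = sqrt (log 2 a)"
  define t0 where "t0 = log 2 (3 * a) + L"
  assume "\<not> ?thesis"
  then have gt: "t > t0" by (simp add: t0_def L_def)
  have L: "L \<ge> 0" "log 2 a = L\<^sup>2" using a by (auto simp: L_def)
  have "log 2 3 \<le> (8/5 :: real)" using ln_three_le by (simp add: log_def field_simps)
  then have "t0 \<le> 8/5 + L\<^sup>2 + L" using a L by (simp add: t0_def log_mult)
  then have "t0 + 1 < 3 * 2 powr L" using two_powr_ge_quadratic[OF L(1)] by linarith
  then have "a * (t0 + 1) < a * (3 * 2 powr L)" using a by simp
  moreover have t0: "2 powr t0 = a * (3 * 2 powr L)"
    using a by (simp add: t0_def powr_add)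
  \<comment> \<open>Here \<open>a \<ge> 1\<close> weakens \<open>t0 * a + a\<close> to
    \<open>t0 * a + 1\<close>.\<close>
  ultimately have *: "t0 * a + 1 < 2 powr t0" using a by (simp add: algebra_simps)
  have "2 powr L \<ge> 1" using L by (simp add: ge_one_powr_ge_zero)
  then have ge: "2 powr t0 \<ge> 3 * a" using t0 a by simp
  have "1 + 5/8 * (t - t0) \<le> 1 + ln 2 * (t - t0)"
    using gt mult_right_mono[OF ln_two_ge, of "t - t0"] by simp
  also have "\<dots> \<le> exp (ln 2 * (t - t0))" by (rule exp_ge_add_one_self)
  also have "\<dots> = 2 powr (t - t0)" by (simp add: powr_def mult.commute)
  finally have "2 powr t0 * (1 + 5/8 * (t - t0)) \<le> 2 powr t0 * 2 powr (t - t0)" by simp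
  also have "\<dots> = 2 powr t" by (simp flip: powr_add)
  finally have "2 powr t0 + 2 powr t0 * (5/8 * (t - t0)) \<le> 2 powr t" by (simp add: algebra_simps)
  moreover have "2 powr t0 * (5/8 * (t - t0)) \<ge> 3 * a * (5/8 * (t - t0))"
    using ge gt by (intro mult_right_mono) auto
  moreover have "3 * a * (5/8 * (t - t0)) \<ge> a * (t - t0)" using a gt by simp
  moreover have "t * a = t0 * a + a * (t - t0)" by (simp add: algebra_simps)
  ultimately show False using * t by linarith
qed

section \<open>Optimal solutions and support reduction\<close>

lemma ilp_feasible_iff:
  assumes "A \<in> carrier_mat m n" "b \<in> carrier_vec m"
  shows "x \<in> ilp_feasible A b \<longleftrightarrow> dim_vec x = n \<and>
    (\<forall>r<m. (\<Sum>i<n. A $$ (r, i) * x $ i) = b $ r) \<and> (\<forall>i<n. 0 \<le> x $ i)"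
  using assms by (auto simp: ilp_feasible_def vec_eq_iff scalar_prod_def atLeast0LessThan
      intro!: sum.cong)

text \<open>The objective takes integer values, so its distance to a bound is a natural number and
  attains a minimum; \<open>nat\<close> truncates nothing on feasible points.\<close>

lemma ilp_optimal_exists:
  assumes "ilp_feasible A b \<noteq> {}" and "ilp_bounded sense A b c"
  shows "\<exists>x. ilp_optimal sense A b c x"
proof -
  obtain x0 where x0: "x0 \<in> ilp_feasible A b" using assms(1) by blast
  show ?thesis
  proof (cases sense)
    case Maximize
    then obtain u where u: "\<And>x. x \<in> ilp_feasible A b \<Longrightarrow> c \<bullet> x \<le> u"
      using assms(2) by (auto simp: bdd_above_def)
    obtain x where "x \<in> ilp_feasible A b"
      and "\<And>y. y \<in> ilp_feasible A b \<Longrightarrow> nat (u - c \<bullet> x) \<le> nat (u - c \<bullet> y)"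
      using ex_has_least_nat[of "\<lambda>x. x \<in> ilp_feasible A b" _ "\<lambda>x. nat (u - c \<bullet> x)", OF x0] by blast
    then have "ilp_optimal Maximize A b c x" using u by (fastforce simp: nat_le_eq_zle)
    then show ?thesis using Maximize by blast
  next
    case Minimize
    then obtain l where l: "\<And>x. x \<in> ilp_feasible A b \<Longrightarrow> l \<le> c \<bullet> x"
      using assms(2) by (auto simp: bdd_below_def)
    obtain x where "x \<in> ilp_feasible A b"
      and "\<And>y. y \<in> ilp_feasible A b \<Longrightarrow> nat (c \<bullet> x - l) \<le> nat (c \<bullet> y - l)"
      using ex_has_least_nat[of "\<lambda>x. x \<in> ilp_feasible A b" _ "\<lambda>x. nat (c \<bullet> x - l)", OF x0] by blast
    then have "ilp_optimal Minimize A b c x" using l by (fastforce simp: nat_le_eq_zle)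
    then show ?thesis using Minimize by blast
  qed
qed

text \<open>Since \<open>x + d\<close> and \<open>x - d\<close> are both feasible, optimality of
  \<open>x\<close> forces the objective to vanish on \<open>d\<close>. Every feasible
  \<open>x + k * d\<close> then has the same value as \<open>x\<close>.\<close>

lemma ilp_optimal_shift:
  fixes d :: "nat \<Rightarrow> int"
  assumes A: "A \<in> carrier_mat m n" and b: "b \<in> carrier_vec m" and c: "c \<in> carrier_vec n"
    and opt: "ilp_optimal sense A b c x"
    and ker: "\<And>r. r < m \<Longrightarrow> (\<Sum>i<n. A $$ (r, i) * d i) = 0"
    and le: "\<And>i. i < n \<Longrightarrow> \<bar>d i\<bar> \<le> x $ i"
    and nonneg: "\<And>i. i < n \<Longrightarrow> 0 \<le> x $ i + k * d i"
  shows "ilp_optimal sense A b c (vec n (\<lambda>i. x $ i + k * d i))"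
proof -
  define z where "z l = vec n (\<lambda>i. x $ i + l * d i)" for l
  have x: "x \<in> ilp_feasible A b" using opt by (cases sense) auto
  have feas: "z l \<in> ilp_feasible A b" if "\<And>i. i < n \<Longrightarrow> 0 \<le> x $ i + l * d i" for l
    using x ker that
    by (auto simp: ilp_feasible_iff[OF A b] z_def algebra_simps sum.distrib
        simp flip: sum_distrib_left)
  have obj: "c \<bullet> z l = c \<bullet> x + l * (\<Sum>i<n. c $ i * d i)" for l
    using x c by (auto simp: ilp_feasible_iff[OF A b] z_def scalar_prod_def atLeast0LessThan
        algebra_simps sum.distrib sum_distrib_left)
  have "z 1 \<in> ilp_feasible A b" "z (-1) \<in> ilp_feasible A b"
    by (rule feas; use le in \<open>force simp: abs_le_iff\<close>)+
  \<comment> \<open>The two disjuncts are the two senses of optimization; either one makes the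
    objective change along \<open>d\<close> zero.\<close>
  then have "c \<bullet> z 1 \<le> c \<bullet> x \<and> c \<bullet> z (-1) \<le> c \<bullet> x \<or> c \<bullet> x \<le> c \<bullet> z 1 \<and> c \<bullet> x \<le> c \<bullet> z (-1)"
    using opt by (cases sense) auto
  then have "(\<Sum>i<n. c $ i * d i) = 0" by (auto simp: obj)
  then have "c \<bullet> z k = c \<bullet> x" using obj by simp
  moreover have "z k \<in> ilp_feasible A b" using feas nonneg by simp
  ultimately show ?thesis using opt by (cases sense) (auto simp: z_def)
qed

lemma ilp_optimal_smaller_support:
  assumes A: "A \<in> carrier_mat m n" and b: "b \<in> carrier_vec m" and c: "c \<in> carrier_vec n"
    and opt: "ilp_optimal sense A b c x"
    and sub: "S \<subseteq> vec_supp x" "T \<subseteq> vec_supp x" and ne: "\<not> T \<subseteq> S"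
    and eq: "\<And>r. r < m \<Longrightarrow> (\<Sum>j\<in>S. A $$ (r, j)) = (\<Sum>j\<in>T. A $$ (r, j))"
  shows "\<exists>y. ilp_optimal sense A b c y \<and> card (vec_supp y) < card (vec_supp x)"
proof -
  have x: "x \<in> ilp_feasible A b" using opt by (cases sense) auto
  then have dim: "dim_vec x = n" and x0: "\<And>i. i < n \<Longrightarrow> 0 \<le> x $ i"
    by (auto simp: ilp_feasible_iff[OF A b])
  have fin: "finite (vec_supp x)" by (simp add: vec_supp_def)
  have suppD: "i < n" "x $ i \<ge> 1" if "i \<in> vec_supp x" for i
    using that x0[of i] by (auto simp: vec_supp_def dim)
  \<comment> \<open>Equal column sums make \<open>d\<close> a kernel vector. It is nonzero only on
    the support of \<open>x\<close>, where \<open>x\<close> is at least 1, so one step in either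
    direction stays feasible.\<close>
  define d :: "nat \<Rightarrow> int" where "d i = of_bool (i \<in> S) - of_bool (i \<in> T)" for i
  have sum_ind: "(\<Sum>i<n. A $$ (r, i) * of_bool (i \<in> U)) = (\<Sum>j\<in>U. A $$ (r, j))"
    if "U \<subseteq> vec_supp x" for U r
  proof -
    have "{..<n} \<inter> U = U" using that suppD by auto
    then show ?thesis by (simp add: of_bool_def if_distrib sum.If_cases cong: if_cong)
  qed
  \<comment> \<open>Moving along \<open>d\<close> decreases only the coordinates in
    \<open>T - S\<close>, which is nonempty by \<open>ne\<close>. Their least value is the longest
    feasible move, and it brings the coordinate \<open>i0\<close> to 0.\<close>
  define k where "k = Min ((\<lambda>i. x $ i) ` (T - S))"
  have finT: "finite (T - S)" using finite_subset[OF sub(2) fin] by simp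
  have "k \<in> (\<lambda>i. x $ i) ` (T - S)"
    unfolding k_def using finT ne by (intro Min_in) auto
  then obtain i0 where i0: "i0 \<in> T - S" "k = x $ i0" by auto
  have k: "k \<le> x $ i" if "i \<in> T - S" for i unfolding k_def using finT that by simp
  have k1: "k \<ge> 1" using i0 suppD sub by auto
  define y where "y = vec n (\<lambda>i. x $ i + k * d i)"
  have "ilp_optimal sense A b c y" unfolding y_def
  proof (rule ilp_optimal_shift[OF A b c opt])
    fix r assume "r < m"
    then show "(\<Sum>i<n. A $$ (r, i) * d i) = 0"
      using eq sum_ind sub by (simp add: d_def right_diff_distrib sum_subtractf)
  next
    fix i assume i: "i < n"
    show "\<bar>d i\<bar> \<le> x $ i"
      using suppD(2)[of i] sub x0[OF i] by (auto simp: d_def of_bool_def)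
    show "0 \<le> x $ i + k * d i"
      using k[of i] k1 x0[OF i] by (auto simp: d_def of_bool_def)
  qed
  moreover have "vec_supp y \<subset> vec_supp x"
  proof
    show "vec_supp y \<subseteq> vec_supp x"
      using sub by (auto simp: vec_supp_def y_def d_def dim of_bool_def split: if_splits)
    have "i0 \<in> vec_supp x" "i0 \<notin> vec_supp y"
      using i0 sub suppD by (auto simp: vec_supp_def y_def d_def)
    then show "vec_supp y \<noteq> vec_supp x" by auto
  qed
  ultimately show ?thesis using psubset_card_mono[OF fin] by blast
qed

section \<open>The support bound\<close>

theorem theorem2:
  fixes A :: "int mat" and b c :: "int vec" and m n :: nat and sense :: ilp_sense
  assumes "A \<in> carrier_mat m n" and "b \<in> carrier_vec m" and "c \<in> carrier_vec n"
    and "max_col_norm1 A \<ge> 1"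
    and "ilp_feasible A b \<noteq> {}"
    and "ilp_bounded sense A b c"
  shows "\<exists>x. ilp_optimal sense A b c x \<and>
    real (card (vec_supp x)) \<le>
      real m * (log 2 (3 * real_of_int (max_col_norm1 A)) + sqrt (log 2 (real_of_int (max_col_norm1 A))))"
proof -
  note A = assms(1) and b = assms(2) and c = assms(3)
  define a where "a = real_of_int (max_col_norm1 A)"
  have a: "a \<ge> 1" using assms(4) by (simp add: a_def)
  obtain x where opt: "ilp_optimal sense A b c x"
    and minimal: "\<And>y. ilp_optimal sense A b c y \<Longrightarrow> card (vec_supp x) \<le> card (vec_supp y)"
    using ilp_optimal_exists[OF assms(5,6)]
      ex_has_least_nat[of "ilp_optimal sense A b c" _ "\<lambda>x. card (vec_supp x)"] by blast
  define S where "S = vec_supp x"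
  define s where "s = card S"
  have "x \<in> ilp_feasible A b" using opt by (cases sense) auto
  then have S: "finite S" "S \<subseteq> {..<n}"
    by (auto simp: ilp_feasible_iff[OF A b] S_def vec_supp_def)
  have inj: "inj_on (\<lambda>T. \<lambda>r\<in>{..<m}. \<Sum>j\<in>T. A $$ (r, j)) (Pow S)"
  proof (rule inj_onI)
    fix T U
    assume sub: "T \<in> Pow S" "U \<in> Pow S"
      and "(\<lambda>r\<in>{..<m}. \<Sum>j\<in>T. A $$ (r, j)) = (\<lambda>r\<in>{..<m}. \<Sum>j\<in>U. A $$ (r, j))"
    then have eq: "(\<Sum>j\<in>T. A $$ (r, j)) = (\<Sum>j\<in>U. A $$ (r, j))" if "r < m" for r
      using that by (auto dest: fun_cong[of _ _ r])
    have no_smaller: "\<not> (\<exists>y. ilp_optimal sense A b c y \<and> card (vec_supp y) < card (vec_supp x))"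
      using minimal by (auto simp: not_less)
    show "T = U"
    proof (rule ccontr)
      assume "T \<noteq> U"
      \<comment> \<open>The reduction needs a column of one set outside the other. Which set
        supplies it is unknown, so it is applied with the roles of \<open>T\<close> and
        \<open>U\<close> in either order.\<close>
      then consider "\<not> T \<subseteq> U" | "\<not> U \<subseteq> T" by blast
      then show False
        using ilp_optimal_smaller_support[OF A b c opt, of U T]
          ilp_optimal_smaller_support[OF A b c opt, of T U] sub eq no_smaller
        by cases (simp_all add: S_def)
    qed
  qed
  have col_le: "(\<Sum>r<m. \<bar>A $$ (r, j)\<bar>) \<le> max_col_norm1 A" if "j < n" for j
  proof -
    have "(\<Sum>r<m. \<bar>A $$ (r, j)\<bar>) = vec_norm1 (col A j)"
      using A that by (auto simp: vec_norm1_def intro!: sum.cong)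
    also have "\<dots> \<le> max_col_norm1 A"
      unfolding max_col_norm1_def using A that by (intro Max_ge) auto
    finally show ?thesis .
  qed
  define R where "R r = (\<Sum>j\<in>S. \<bar>A $$ (r, j)\<bar>)" for r
  \<comment> \<open>Double counting: the row norms on the support are regrouped by columns, each of
    norm at most \<open>max_col_norm1 A\<close>.\<close>
  have "(\<Sum>r<m. R r) = (\<Sum>j\<in>S. \<Sum>r<m. \<bar>A $$ (r, j)\<bar>)"
    unfolding R_def by (rule sum.swap)
  also have "\<dots> \<le> (\<Sum>j\<in>S. max_col_norm1 A)" using col_le S by (intro sum_mono) auto
  finally have "(\<Sum>r<m. R r) \<le> s * max_col_norm1 A" by (simp add: s_def)
  then have sum_R: "(\<Sum>r<m. real_of_int (R r)) \<le> s * a"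
    unfolding a_def by (metis of_int_le_iff of_int_mult of_int_of_nat_eq of_int_sum)
  have R0: "R r \<ge> 0" for r by (simp add: R_def sum_nonneg)
  have count: "(2::real) ^ s \<le> (\<Prod>r<m. 1 + real_of_int (R r))"
  proof -
    have "(2::int) ^ s \<le> (\<Prod>r<m. 1 + R r)"
      unfolding s_def R_def by (rule card_inj_subset_sums_le[OF S(1) inj])
    then have "real_of_int (2 ^ s) \<le> real_of_int (\<Prod>r<m. 1 + R r)" by (simp only: of_int_le_iff)
    then show ?thesis by simp
  qed
  have "real s \<le> m * (log 2 (3 * a) + sqrt (log 2 a))"
  proof (cases "m = 0")
    \<comment> \<open>Without rows the ratio \<open>s / m\<close> is meaningless, but the empty
      product in \<open>count\<close> forces \<open>s = 0\<close>.\<close>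
    case True
    with count have "(2::real) ^ s \<le> 1" by simp
    then have "real s < 1" by (rule less_le_trans[OF of_nat_less_two_power])
    with True show ?thesis by simp
  next
    case False
    define t where "t = s / m"
    have s: "real s = m * t" and t0: "t \<ge> 0" using False by (auto simp: t_def)
    have "(\<Prod>r<m. 1 + real_of_int (R r)) \<le> (1 + t * a) ^ m"
    proof (rule prod_le_mean_power)
      show "0 < 1 + real_of_int (R r)" for r using R0[of r] by simp
      show "0 < 1 + t * a" using t0 a by (simp add: add_pos_nonneg)
      show "(\<Sum>r<m. 1 + real_of_int (R r)) \<le> m * (1 + t * a)"
        using sum_R s by (simp add: sum.distrib algebra_simps)
    qed
    with count have "2 ^ s \<le> (1 + t * a) ^ m" by linarith
    \<comment> \<open>Writing \<open>2 ^ s\<close> as an \<open>m\<close>-th power allows the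
      exponent \<open>m\<close> to be cancelled on both sides.\<close>
    moreover have "(2::real) ^ s = (2 powr t) ^ m"
      using s by (simp add: powr_realpow[symmetric] powr_powr mult.commute)
    ultimately have "2 powr t \<le> 1 + t * a"
      using False a t0 by (simp add: power_mono_iff)
    then have "t \<le> log 2 (3 * a) + sqrt (log 2 a)" by (rule two_powr_le_linear_imp_le[OF a])
    then show ?thesis unfolding s by (intro mult_left_mono) auto
  qed
  then show ?thesis using opt by (auto simp: a_def s_def S_def)
qed

end
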